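(* Let $\mathcal{H}$ be a nonzero complex Hilbert space and $T,S\in\mathbb{B}(\mathcal{H})$. The following statements are equivalent. (i) For each $\theta\in[0,2\pi)$ there exists a sequence $\{x_n\}$ of unit vectors in $\mathcal{H}$ such that $\lim_{n\to\infty}\|Tx_n\|=\|T\|$ and $\lim_{n\to\infty}\mathrm{Re}\big(e^{i\theta}\langle Sx_n,Tx_n\rangle\big)\ge 0$. (ii) For all $\xi\in\mathbb{C}$, $\ \|T+\xi S\|^2\ge\|T\|^2+|\xi|^2[S]^2$. (iii) $T\perp_B S$, that is, $\|T+\xi S\|\ge\|T\|$ for all $\xi\in\mathbb{C}$.
   Context: $\mathbb{B}(\mathcal{H})$ is the algebra of all bounded linear operators on the complex Hilbert space $(\mathcal{H},\langle\cdot,\cdot\rangle)$, with inner product linear in the first argument, and $\|T\|$ is the usual operator norm. The minimum modulus of $S\in\mathbb{B}(\mathcal{H})$ is $[S]=\inf\{\|Sx\|:\ x\in\mathcal{H},\ \|x\|=1\}$. $T\perp_B S$ denotes Birkhoff--James orthogonality. In (i), the second condition asserts that the limit exists and is nonnegative. *)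

theory Defs
  imports "HOL-Analysis.Analysis"
begin

class complex_vector = real_vector +
  fixes scaleC :: "complex \<Rightarrow> 'a \<Rightarrow> 'a"  (infixr "*\<^sub>C" 75)
  assumes scaleC_add_right: "a *\<^sub>C (x + y) = a *\<^sub>C x + a *\<^sub>C y"
    and scaleC_add_left: "(a + b) *\<^sub>C x = a *\<^sub>C x + b *\<^sub>C x"
    and scaleC_scaleC: "a *\<^sub>C (b *\<^sub>C x) = (a * b) *\<^sub>C x"
    and scaleC_one: "1 *\<^sub>C x = x"
    and scaleR_scaleC: "r *\<^sub>R x = complex_of_real r *\<^sub>C x"

text \<open>
  The inner product is linear in the first argument and conjugate-linear in the second.
  The real normed space underlying a complex inner product space is part of the class, so
  the library notions of limit, completeness and operator norm apply; the last axiom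
  says that its norm is the one induced by the inner product.
\<close>

class complex_inner = complex_vector + real_normed_vector +
  fixes cinner :: "'a \<Rightarrow> 'a \<Rightarrow> complex"
  assumes cinner_add_left: "cinner (x + y) z = cinner x z + cinner y z"
    and cinner_scaleC_left: "cinner (a *\<^sub>C x) y = a * cinner x y"
    and cinner_commute: "cinner x y = cnj (cinner y x)"
    and cinner_self_nonneg: "0 \<le> Re (cinner x x)"
    and cinner_self_eq_zero_iff: "cinner x x = 0 \<longleftrightarrow> x = 0"
    and norm_eq_sqrt_cinner: "norm x = sqrt (Re (cinner x x))"

class complex_hilbert = complex_inner + complete_space

instantiation complex :: complex_hilbert
begin

definition scaleC_complex :: "complex \<Rightarrow> complex \<Rightarrow> complex"
  where "scaleC_complex a x = a * x"

definition cinner_complex :: "complex \<Rightarrow> complex \<Rightarrow> complex"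
  where "cinner_complex x y = x * cnj y"

instance
proof
  fix a b x y z :: complex and r :: real
  show "a *\<^sub>C (x + y) = a *\<^sub>C x + a *\<^sub>C y"
    by (simp add: scaleC_complex_def distrib_left)
  show "(a + b) *\<^sub>C x = a *\<^sub>C x + b *\<^sub>C x"
    by (simp add: scaleC_complex_def distrib_right)
  show "a *\<^sub>C (b *\<^sub>C x) = (a * b) *\<^sub>C x"
    by (simp add: scaleC_complex_def)
  show "1 *\<^sub>C x = x"
    by (simp add: scaleC_complex_def)
  show "r *\<^sub>R x = complex_of_real r *\<^sub>C x"
    by (simp add: scaleC_complex_def scaleR_conv_of_real)
  show "cinner (x + y) z = cinner x z + cinner y z"
    by (simp add: cinner_complex_def distrib_right)
  show "cinner (a *\<^sub>C x) y = a * cinner x y"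
    by (simp add: cinner_complex_def scaleC_complex_def)
  show "cinner x y = cnj (cinner y x)"
    by (simp add: cinner_complex_def)
  show "0 \<le> Re (cinner x x)"
    by (simp add: cinner_complex_def)
  show "cinner x x = 0 \<longleftrightarrow> x = 0"
    by (simp add: cinner_complex_def)
  show "norm x = sqrt (Re (cinner x x))"
    by (simp add: cinner_complex_def cmod_def power2_eq_square)
qed

end

definition bounded_clinear :: "('a::complex_inner \<Rightarrow> 'a) \<Rightarrow> bool"
  where "bounded_clinear T \<longleftrightarrow>
    bounded_linear T \<and> (\<forall>c x. T (c *\<^sub>C x) = c *\<^sub>C T x)"

definition min_modulus :: "('a::complex_inner \<Rightarrow> 'a) \<Rightarrow> real"
  where "min_modulus S = Inf {norm (S x) | x. norm x = 1}"

definition birkhoff_james_orthogonal ::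
    "('a::complex_inner \<Rightarrow> 'a) \<Rightarrow> ('a \<Rightarrow> 'a) \<Rightarrow> bool"  (infix "\<bottom>\<^sub>B" 50)
  where "T \<bottom>\<^sub>B S \<longleftrightarrow> (\<forall>\<xi>::complex. onorm (\<lambda>x. T x + \<xi> *\<^sub>C S x) \<ge> onorm T)"

end

theory Submission
  imports Defs
begin

text \<open>
  Everything rests on the expansion (\<open>norm_add_scaleC_power2\<close>), for a unit vector \<open>x\<close>,

    \<open>\<parallel>Tx + \<xi>Sx\<parallel>\<^sup>2 = \<parallel>Tx\<parallel>\<^sup>2 + \<bar>\<xi>\<bar>\<^sup>2 \<parallel>Sx\<parallel>\<^sup>2 + 2 Re(\<xi> \<langle>Sx, Tx\<rangle>)\<close>,

  whose last summand is called the cross term in what follows (up to a positive factor).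

  If unit vectors \<open>x n\<close> asymptotically attain the norm of \<open>T\<close> and the cross term in the
  direction \<open>\<theta> = arg \<xi>\<close> is nonnegative in the limit, then the limit inferior of the right-hand
  side is at least \<open>\<parallel>T\<parallel>\<^sup>2 + \<bar>\<xi>\<bar>\<^sup>2 [S]\<^sup>2\<close>, while the left-hand side never exceeds
  \<open>\<parallel>T + \<xi>S\<parallel>\<^sup>2\<close>: condition (i) gives (ii), see \<open>onorm_add_scaleC_lower_bound\<close>. Dropping the
  nonnegative summand with \<open>[S]\<close> gives (iii).

  For the way back from (iii) to (i), fix a direction \<open>u\<close> on the unit circle and let a step
  \<open>r > 0\<close> tend to 0. Choose a unit vector \<open>x\<close> at which \<open>T + r u S\<close> attains the square of its
  norm up to an error \<open>r\<^sup>2\<close>, an error of smaller order than the cross term. Orthogonality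
  then turns the expansion into (\<open>exists_unit_vector_near_norming\<close>)

    \<open>\<parallel>T\<parallel>\<^sup>2 - \<parallel>Tx\<parallel>\<^sup>2 \<le> 2 r Re(u \<langle>Sx, Tx\<rangle>) + r\<^sup>2 (\<parallel>S\<parallel>\<^sup>2 + 1)\<close>.

  The left-hand side is nonnegative, so division by \<open>r\<close> shows that the cross term is at least
  a quantity tending to 0; and the right-hand side tends to 0, so \<open>\<parallel>Tx\<parallel>\<close> tends to
  \<open>\<parallel>T\<parallel>\<close>. The cross terms are bounded, so they converge along a subsequence, and this
  subsequence is the one demanded in (i)
  (\<open>exists_norming_sequence_nonneg_cross_term\<close>).
\<close>

section \<open>Complex inner product spaces\<close>

lemma norm_power2_eq_cinner: "(norm x)\<^sup>2 = Re (cinner x x)"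
  for x :: "'a::complex_inner"
  by (simp add: norm_eq_sqrt_cinner cinner_self_nonneg)

lemma cinner_add_right: "cinner x (y + z) = cinner x y + cinner x z"
  for x y z :: "'a::complex_inner"
proof -
  have "cinner x (y + z) = cnj (cinner (y + z) x)"
    by (rule cinner_commute)
  also have "\<dots> = cnj (cinner y x) + cnj (cinner z x)"
    by (simp add: cinner_add_left)
  also have "\<dots> = cinner x y + cinner x z"
    using cinner_commute[of x y] cinner_commute[of x z] by simp
  finally show ?thesis .
qed

lemma cinner_scaleC_right: "cinner x (c *\<^sub>C y) = cnj c * cinner x y"
  for x y :: "'a::complex_inner"
proof -
  have "cinner x (c *\<^sub>C y) = cnj (c * cinner y x)"
    using cinner_commute[of x "c *\<^sub>C y"] by (simp add: cinner_scaleC_left)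
  also have "\<dots> = cnj c * cinner x y"
    using cinner_commute[of x y] by simp
  finally show ?thesis .
qed

lemma norm_scaleC: "norm (c *\<^sub>C x) = cmod c * norm x"
  for x :: "'a::complex_inner"
proof -
  have "cinner (c *\<^sub>C x) (c *\<^sub>C x) = of_real ((cmod c)\<^sup>2) * cinner x x"
    by (simp add: cinner_scaleC_left cinner_scaleC_right complex_norm_square mult.assoc
        del: of_real_power)
  then have "(norm (c *\<^sub>C x))\<^sup>2 = (cmod c * norm x)\<^sup>2"
    by (simp add: norm_power2_eq_cinner power_mult_distrib del: of_real_power)
  then show ?thesis
    by (simp add: power2_eq_iff_nonneg)
qed

lemma norm_add_power2: "(norm (x + y))\<^sup>2 = (norm x)\<^sup>2 + (norm y)\<^sup>2 + 2 * Re (cinner y x)"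
  for x y :: "'a::complex_inner"
proof -
  have "Re (cinner x y) = Re (cinner y x)"
    using cinner_commute[of x y] by simp
  then show ?thesis
    by (simp add: norm_power2_eq_cinner cinner_add_left cinner_add_right)
qed

lemma norm_add_scaleC_power2:
  "(norm (x + c *\<^sub>C y))\<^sup>2 = (norm x)\<^sup>2 + (cmod c)\<^sup>2 * (norm y)\<^sup>2 + 2 * Re (c * cinner y x)"
  for x y :: "'a::complex_inner"
  by (simp add: norm_add_power2 norm_scaleC cinner_scaleC_left power_mult_distrib)

text \<open>
  The real part of the Cauchy--Schwarz inequality is the triangle inequality for
  \<open>x + y\<close> and its reverse, read through the expansion of \<open>\<parallel>x + y\<parallel>\<^sup>2\<close>.
\<close>

lemma abs_Re_cinner_le: "\<bar>Re (cinner y x)\<bar> \<le> norm y * norm x"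
  for x y :: "'a::complex_inner"
proof -
  have "(norm (x + y))\<^sup>2 \<le> (norm x + norm y)\<^sup>2"
    by (simp add: norm_triangle_ineq)
  moreover have "(norm x - norm y)\<^sup>2 \<le> (norm (x + y))\<^sup>2"
    using norm_diff_ineq[of x y] norm_diff_ineq[of y x]
    by (intro abs_le_square_iff[THEN iffD1]) (simp add: add.commute abs_le_iff)
  ultimately show ?thesis
    by (simp add: norm_add_power2 power2_sum power2_diff mult.commute)
qed

section \<open>Operator norm and minimum modulus\<close>

lemma bounded_linear_scaleC: "bounded_linear (\<lambda>x::'a::complex_inner. c *\<^sub>C x)"
proof (rule bounded_linear_intro[where K = "cmod c"])
  show "c *\<^sub>C (r *\<^sub>R x) = r *\<^sub>R (c *\<^sub>C x)" for r and x :: 'a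
    by (simp add: scaleR_scaleC scaleC_scaleC mult.commute)
qed (simp_all add: scaleC_add_right norm_scaleC mult.commute)

lemma bounded_linear_add_scaleC:
  fixes T S :: "'a::real_normed_vector \<Rightarrow> 'b::complex_inner"
  assumes "bounded_linear T" "bounded_linear S"
  shows "bounded_linear (\<lambda>x. T x + c *\<^sub>C S x)"
  using assms bounded_linear_compose[OF bounded_linear_scaleC[of c]]
  by (intro bounded_linear_add) auto

text \<open>
  By homogeneity, a bound for \<open>A\<close> on the unit sphere is a bound for its operator norm, so
  unit vectors come arbitrarily close to attaining that norm. The square is what the expansion
  of \<open>\<parallel>x + cy\<parallel>\<^sup>2\<close> controls.
\<close>

lemma exists_unit_vector_norm_power2_gt:
  fixes A :: "'a::real_normed_vector \<Rightarrow> 'b::real_normed_vector"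
  assumes A: "bounded_linear A" and nonzero: "\<exists>x::'a. x \<noteq> 0"
    and c: "c < (onorm A)\<^sup>2"
  shows "\<exists>x. norm x = 1 \<and> c < (norm (A x))\<^sup>2"
proof (rule ccontr)
  assume "\<not> ?thesis"
  then have le: "(norm (A x))\<^sup>2 \<le> c" if "norm x = 1" for x
    using that by force
  obtain z :: 'a where "z \<noteq> 0"
    using nonzero by blast
  then have "(norm (A (sgn z)))\<^sup>2 \<le> c"
    by (intro le) (simp add: norm_sgn)
  then have c0: "0 \<le> c"
    by (rule order_trans[OF zero_le_power2])
  have "norm (A x) \<le> sqrt c * norm x" for x
  proof (cases "x = 0")
    case True
    then show ?thesis
      using linear_0[OF bounded_linear.linear[OF A]] by simp
  next
    case False
    then have "norm (A (sgn x)) \<le> sqrt c"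
      by (intro real_le_rsqrt le) (simp add: norm_sgn)
    moreover have "norm (A (sgn x)) = norm (A x) / norm x"
      by (simp add: sgn_div_norm linear_scale[OF bounded_linear.linear[OF A]]
          divide_inverse mult.commute)
    ultimately show ?thesis
      using False by (simp add: divide_le_eq)
  qed
  then have "onorm A \<le> sqrt c"
    using c0 by (intro onorm_bound) simp_all
  then have "(onorm A)\<^sup>2 \<le> c"
    using power_mono[OF _ onorm_pos_le[OF A], of "sqrt c" 2] c0 by simp
  then show False
    using c by simp
qed

lemma norm_le_onorm_unit:
  assumes "bounded_linear A" "norm x = 1"
  shows "norm (A x) \<le> onorm A"
  using onorm[OF assms(1), of x] assms(2) by simp

lemma min_modulus_le: "min_modulus S \<le> norm (S x)" if "norm x = 1"
  unfolding min_modulus_def using that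
  by (intro cInf_lower bdd_belowI[of _ 0]) auto

text \<open>
  A unit vector must exist: in the zero space the infimum would range over the empty set,
  where it has no specified value.
\<close>

lemma min_modulus_nonneg:
  fixes S :: "'a::complex_inner \<Rightarrow> 'a"
  assumes "norm (x::'a) = 1"
  shows "0 \<le> min_modulus S"
  unfolding min_modulus_def using assms
  by (intro cInf_greatest) auto

section \<open>Norming sequences and orthogonality\<close>

text \<open>
  Along \<open>x\<close> the expansion of \<open>\<parallel>Tx + \<xi>Sx\<parallel>\<^sup>2\<close> is bounded below by terms that converge, with
  the minimum modulus absorbing the term \<open>\<parallel>Sx\<parallel>\<^sup>2\<close>, which need not converge. Writing
  \<open>\<xi> = r u\<close> with \<open>r \<ge> 0\<close> keeps the sign of the limiting cross term.
\<close>

lemma onorm_add_scaleC_lower_bound: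
  fixes T S :: "'a::complex_inner \<Rightarrow> 'a"
  assumes T: "bounded_linear T" and S: "bounded_linear S"
    and unit: "\<And>n. norm (x n) = 1"
    and norming: "(\<lambda>n::nat. norm (T (x n))) \<longlonglongrightarrow> onorm T"
    and cross: "(\<lambda>n. Re (u * cinner (S (x n)) (T (x n)))) \<longlonglongrightarrow> L" and L: "0 \<le> L"
    and r: "0 \<le> r" and u: "cmod u = 1"
  shows "(onorm T)\<^sup>2 + r\<^sup>2 * (min_modulus S)\<^sup>2 \<le> (onorm (\<lambda>x. T x + (of_real r * u) *\<^sub>C S x))\<^sup>2"
    (is "_ \<le> (onorm ?A)\<^sup>2")
proof -
  have bound: "(norm (T (x n)))\<^sup>2 + r\<^sup>2 * (min_modulus S)\<^sup>2
      + 2 * r * Re (u * cinner (S (x n)) (T (x n))) \<le> (onorm ?A)\<^sup>2" for n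
  proof -
    have "r\<^sup>2 * (min_modulus S)\<^sup>2 \<le> r\<^sup>2 * (norm (S (x n)))\<^sup>2"
      using min_modulus_le[OF unit] min_modulus_nonneg[OF unit]
      by (intro mult_left_mono power_mono) auto
    then have "(norm (T (x n)))\<^sup>2 + r\<^sup>2 * (min_modulus S)\<^sup>2
        + 2 * r * Re (u * cinner (S (x n)) (T (x n))) \<le> (norm (?A (x n)))\<^sup>2"
      using u r by (simp add: norm_add_scaleC_power2 norm_mult mult.assoc
          del: Re_complex_of_real times_complex.sel)
        (simp add: algebra_simps)
    also have "\<dots> \<le> (onorm ?A)\<^sup>2"
      using norm_le_onorm_unit[OF bounded_linear_add_scaleC[OF T S] unit]
      by (intro power_mono) auto
    finally show ?thesis .
  qed
  have "(\<lambda>n. (norm (T (x n)))\<^sup>2 + r\<^sup>2 * (min_modulus S)\<^sup>2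
      + 2 * r * Re (u * cinner (S (x n)) (T (x n))))
      \<longlonglongrightarrow> (onorm T)\<^sup>2 + r\<^sup>2 * (min_modulus S)\<^sup>2 + 2 * r * L"
    by (intro tendsto_intros norming cross)
  then have "(onorm T)\<^sup>2 + r\<^sup>2 * (min_modulus S)\<^sup>2 + 2 * r * L \<le> (onorm ?A)\<^sup>2"
    by (rule LIMSEQ_le_const2) (use bound in blast)
  moreover have "0 \<le> 2 * r * L"
    using r L by simp
  ultimately show ?thesis
    by linarith
qed

text \<open>
  A unit vector nearly norming \<open>T + r u S\<close> is, to first order in \<open>r\<close>, a norming vector of
  \<open>T\<close> whose cross term cannot be substantially negative. The slack \<open>r\<^sup>2\<close> is small enough to
  survive a later division by \<open>r\<close>.
\<close>

lemma exists_unit_vector_near_norming: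
  fixes T S :: "'a::complex_inner \<Rightarrow> 'a"
  assumes T: "bounded_linear T" and S: "bounded_linear S"
    and nonzero: "\<exists>x::'a. x \<noteq> 0"
    and r: "0 < r" and u: "cmod u = 1"
    and le: "onorm T \<le> onorm (\<lambda>x. T x + (of_real r * u) *\<^sub>C S x)"
  shows "\<exists>x. norm x = 1 \<and> (onorm T)\<^sup>2 - (norm (T x))\<^sup>2
           \<le> 2 * r * Re (u * cinner (S x) (T x)) + r\<^sup>2 * ((onorm S)\<^sup>2 + 1)"
proof -
  let ?A = "\<lambda>x. T x + (of_real r * u) *\<^sub>C S x"
  have le2: "(onorm T)\<^sup>2 \<le> (onorm ?A)\<^sup>2"
    using le onorm_pos_le[OF T] by (intro power_mono)
  moreover have "0 < r\<^sup>2"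
    using r by simp
  ultimately have "(onorm T)\<^sup>2 - r\<^sup>2 < (onorm ?A)\<^sup>2"
    by linarith
  then obtain x where x: "norm x = 1" and gt: "(onorm T)\<^sup>2 - r\<^sup>2 < (norm (?A x))\<^sup>2"
    using exists_unit_vector_norm_power2_gt[OF bounded_linear_add_scaleC[OF T S] nonzero]
    by blast
  have "(norm (?A x))\<^sup>2 = (norm (T x))\<^sup>2 + r\<^sup>2 * (norm (S x))\<^sup>2
      + 2 * r * Re (u * cinner (S x) (T x))"
    using u r by (simp add: norm_add_scaleC_power2 norm_mult mult.assoc
        del: Re_complex_of_real times_complex.sel)
      (simp add: algebra_simps)
  moreover have "r\<^sup>2 * (norm (S x))\<^sup>2 \<le> r\<^sup>2 * (onorm S)\<^sup>2"
    using norm_le_onorm_unit[OF S x] by (intro mult_left_mono power_mono) auto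
  ultimately show ?thesis
    using x gt by (intro exI[of _ x]) (simp add: algebra_simps)
qed

text \<open>
  The norming vectors for steps \<open>r\<close> tending to 0 have cross terms bounded below by a
  multiple of \<open>- r\<close>, hence a nonnegative limit along a subsequence.
\<close>

lemma exists_norming_sequence_nonneg_cross_term:
  fixes T S :: "'a::complex_inner \<Rightarrow> 'a"
  assumes T: "bounded_linear T" and S: "bounded_linear S"
    and nonzero: "\<exists>x::'a. x \<noteq> 0" and u: "cmod u = 1"
    and orth: "\<And>r. 0 < r \<Longrightarrow> onorm T \<le> onorm (\<lambda>x. T x + (of_real r * u) *\<^sub>C S x)"
  shows "\<exists>x::nat \<Rightarrow> 'a. (\<forall>n. norm (x n) = 1) \<and> (\<lambda>n. norm (T (x n))) \<longlonglongrightarrow> onorm T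
    \<and> (\<exists>L::real. (\<lambda>n. Re (u * cinner (S (x n)) (T (x n)))) \<longlonglongrightarrow> L \<and> 0 \<le> L)"
proof -
  define r :: "nat \<Rightarrow> real" where "r n = inverse (real (Suc n))" for n
  have r_pos: "0 < r n" for n
    by (simp add: r_def)
  have r_lim: "r \<longlonglongrightarrow> 0"
    unfolding r_def by (rule LIMSEQ_inverse_real_of_nat)
  define C where "C = (onorm S)\<^sup>2 + 1"
  define M where "M = onorm S * onorm T"
  have "\<forall>n. \<exists>x. norm x = 1 \<and> (onorm T)\<^sup>2 - (norm (T x))\<^sup>2
      \<le> 2 * r n * Re (u * cinner (S x) (T x)) + (r n)\<^sup>2 * C"
    unfolding C_def
    using exists_unit_vector_near_norming[OF T S nonzero r_pos u orth[OF r_pos]] by blast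
  then obtain x where unit: "\<And>n. norm (x n) = 1"
    and near: "\<And>n. (onorm T)\<^sup>2 - (norm (T (x n)))\<^sup>2
      \<le> 2 * r n * Re (u * cinner (S (x n)) (T (x n))) + (r n)\<^sup>2 * C"
    by metis
  define g where "g n = Re (u * cinner (S (x n)) (T (x n)))" for n
  have T_le: "norm (T (x n)) \<le> onorm T" for n
    by (rule norm_le_onorm_unit[OF T unit])
  have g_bound: "\<bar>g n\<bar> \<le> M" for n
  proof -
    have "\<bar>g n\<bar> \<le> norm (u *\<^sub>C S (x n)) * norm (T (x n))"
      using abs_Re_cinner_le[of "u *\<^sub>C S (x n)" "T (x n)"]
      by (simp add: g_def cinner_scaleC_left del: times_complex.sel)
    also have "\<dots> \<le> M"
      using norm_le_onorm_unit[OF S unit] T_le onorm_pos_le[OF S] u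
      by (auto simp: M_def norm_scaleC intro: mult_mono)
    finally show ?thesis .
  qed
  have g_lower: "- (r n * C / 2) \<le> g n" for n
  proof -
    have "0 \<le> (onorm T)\<^sup>2 - (norm (T (x n)))\<^sup>2"
      using T_le by (simp add: power_mono)
    also have "\<dots> \<le> r n * (2 * g n + r n * C)"
      using near[of n] by (simp add: g_def power2_eq_square algebra_simps)
    finally have "0 \<le> 2 * g n + r n * C"
      using r_pos[of n] by (simp add: zero_le_mult_iff)
    then show ?thesis
      by linarith
  qed
  have "(\<lambda>n. (norm (T (x n)))\<^sup>2) \<longlonglongrightarrow> (onorm T)\<^sup>2"
  proof (rule tendsto_sandwich)
    show "\<forall>\<^sub>F n in sequentially. (onorm T)\<^sup>2 - (2 * r n * M + (r n)\<^sup>2 * C) \<le> (norm (T (x n)))\<^sup>2"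
    proof (rule always_eventually, rule allI)
      fix n
      have "2 * r n * g n \<le> 2 * r n * M"
        using g_bound[of n] r_pos[of n] by (intro mult_left_mono) auto
      then show "(onorm T)\<^sup>2 - (2 * r n * M + (r n)\<^sup>2 * C) \<le> (norm (T (x n)))\<^sup>2"
        using near[of n] unfolding g_def by linarith
    qed
    show "\<forall>\<^sub>F n in sequentially. (norm (T (x n)))\<^sup>2 \<le> (onorm T)\<^sup>2"
      using T_le by (simp add: power_mono)
    have "(\<lambda>n. (onorm T)\<^sup>2 - (2 * r n * M + (r n)\<^sup>2 * C))
        \<longlonglongrightarrow> (onorm T)\<^sup>2 - (2 * 0 * M + 0\<^sup>2 * C)"
      by (intro tendsto_intros r_lim)
    then show "(\<lambda>n. (onorm T)\<^sup>2 - (2 * r n * M + (r n)\<^sup>2 * C)) \<longlonglongrightarrow> (onorm T)\<^sup>2"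
      by simp
  qed (rule tendsto_const)
  from tendsto_real_sqrt[OF this] have T_lim: "(\<lambda>n. norm (T (x n))) \<longlonglongrightarrow> onorm T"
    using onorm_pos_le[OF T] by simp
  have "seq_compact {- M..M}"
    by (intro compact_imp_seq_compact compact_Icc)
  moreover have "g n \<in> {- M..M}" for n
    using g_bound[of n] by (simp add: abs_le_iff)
  ultimately obtain L s where s: "strict_mono (s :: nat \<Rightarrow> nat)" and L: "(g \<circ> s) \<longlonglongrightarrow> L"
    using seq_compactE[of "{- M..M}" g] by metis
  have "(\<lambda>n. - (r n * C / 2)) \<longlonglongrightarrow> - (0 * C / 2)"
    by (intro tendsto_intros r_lim) simp
  then have "((\<lambda>n. - (r n * C / 2)) \<circ> s) \<longlonglongrightarrow> 0"
    using LIMSEQ_subseq_LIMSEQ[OF _ s] by fastforce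
  then have "0 \<le> L"
    using L by (rule LIMSEQ_le) (simp add: g_lower)
  then show ?thesis
    using unit L LIMSEQ_subseq_LIMSEQ[OF T_lim s]
    by (intro exI[of _ "x \<circ> s"]) (auto simp: g_def o_def)
qed

theorem corollary2p8:
  fixes T S :: "'a::complex_hilbert \<Rightarrow> 'a"
  assumes nonzero: "\<exists>x::'a. x \<noteq> 0"
    and T: "bounded_clinear T"
    and S: "bounded_clinear S"
  shows
    "((\<forall>\<theta>::real. 0 \<le> \<theta> \<and> \<theta> < 2 * pi \<longrightarrow>
         (\<exists>x :: nat \<Rightarrow> 'a.
            (\<forall>n. norm (x n) = 1)
            \<and> (\<lambda>n. norm (T (x n))) \<longlonglongrightarrow> onorm T
            \<and> (\<exists>L::real. (\<lambda>n. Re (exp (\<i> * complex_of_real \<theta>) * cinner (S (x n)) (T (x n)))) \<longlonglongrightarrow> L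
                   \<and> 0 \<le> L)))
      \<longleftrightarrow>
      (\<forall>\<xi>::complex. (onorm (\<lambda>x. T x + \<xi> *\<^sub>C S x))\<^sup>2
                     \<ge> (onorm T)\<^sup>2 + (cmod \<xi>)\<^sup>2 * (min_modulus S)\<^sup>2))
     \<and>
     ((\<forall>\<xi>::complex. (onorm (\<lambda>x. T x + \<xi> *\<^sub>C S x))\<^sup>2
                     \<ge> (onorm T)\<^sup>2 + (cmod \<xi>)\<^sup>2 * (min_modulus S)\<^sup>2)
      \<longleftrightarrow> T \<bottom>\<^sub>B S)"
proof -
  have T': "bounded_linear T" and S': "bounded_linear S"
    using T S by (simp_all add: bounded_clinear_def)
  have unit_circle: "cmod (exp (\<i> * complex_of_real \<theta>)) = 1" for \<theta>
    by simp
  have lower: "(onorm (\<lambda>x. T x + \<xi> *\<^sub>C S x))\<^sup>2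
      \<ge> (onorm T)\<^sup>2 + (cmod \<xi>)\<^sup>2 * (min_modulus S)\<^sup>2"
    if norming: "\<forall>\<theta>::real. 0 \<le> \<theta> \<and> \<theta> < 2 * pi \<longrightarrow>
         (\<exists>x :: nat \<Rightarrow> 'a. (\<forall>n. norm (x n) = 1) \<and> (\<lambda>n. norm (T (x n))) \<longlonglongrightarrow> onorm T
            \<and> (\<exists>L::real. (\<lambda>n. Re (exp (\<i> * complex_of_real \<theta>) * cinner (S (x n)) (T (x n))))
                 \<longlonglongrightarrow> L \<and> 0 \<le> L))" for \<xi>
  proof -
    let ?u = "exp (\<i> * complex_of_real (Arg2pi \<xi>))"
    obtain x L where "\<And>n::nat. norm (x n :: 'a) = 1" "(\<lambda>n. norm (T (x n))) \<longlonglongrightarrow> onorm T"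
      "(\<lambda>n. Re (?u * cinner (S (x n)) (T (x n)))) \<longlonglongrightarrow> L" "0 \<le> L"
      using norming Arg2pi_ge_0[of \<xi>] Arg2pi_lt_2pi[of \<xi>] by metis
    from onorm_add_scaleC_lower_bound[OF T' S' this norm_ge_zero[of \<xi>] unit_circle]
    show ?thesis
      by (simp flip: Arg2pi_eq)
  qed
  have orthogonal: "T \<bottom>\<^sub>B S"
    if lower: "\<forall>\<xi>::complex. (onorm (\<lambda>x. T x + \<xi> *\<^sub>C S x))\<^sup>2
                 \<ge> (onorm T)\<^sup>2 + (cmod \<xi>)\<^sup>2 * (min_modulus S)\<^sup>2"
    unfolding birkhoff_james_orthogonal_def
  proof
    fix \<xi> :: complex
    have "0 \<le> (cmod \<xi>)\<^sup>2 * (min_modulus S)\<^sup>2"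
      by simp
    then have "(onorm T)\<^sup>2 \<le> (onorm (\<lambda>x. T x + \<xi> *\<^sub>C S x))\<^sup>2"
      using lower[rule_format, of \<xi>] by linarith
    then show "onorm T \<le> onorm (\<lambda>x. T x + \<xi> *\<^sub>C S x)"
      using onorm_pos_le[OF bounded_linear_add_scaleC[OF T' S', of \<xi>]]
      by (rule power2_le_imp_le)
  qed
  have norming: "\<exists>x :: nat \<Rightarrow> 'a. (\<forall>n. norm (x n) = 1) \<and> (\<lambda>n. norm (T (x n))) \<longlonglongrightarrow> onorm T
      \<and> (\<exists>L::real. (\<lambda>n. Re (exp (\<i> * complex_of_real \<theta>) * cinner (S (x n)) (T (x n))))
           \<longlonglongrightarrow> L \<and> 0 \<le> L)" if "T \<bottom>\<^sub>B S" for \<theta>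
    by (rule exists_norming_sequence_nonneg_cross_term[OF T' S' nonzero unit_circle])
      (use that in \<open>simp add: birkhoff_james_orthogonal_def\<close>)
  show ?thesis
    using lower orthogonal norming by blast
qed

end
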